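(* For every $\epsilon>0$ there is a connected graph $G$ of diameter two, with $n$ vertices and minimum degree $\delta$, such that $$\pi^*(G)>\frac{(4-\epsilon)\,n}{\delta+1}.$$
   Context: All graphs are finite and simple. A pebbling distribution $D$ on a graph $G$ is a function $D:V(G)\to\mathbb{Z}_{\ge 0}$ ($D(v)$ pebbles on $v$); its size is $|D|=\sum_v D(v)$. A pebbling move removes two pebbles from a vertex having at least two pebbles and places one pebble on an adjacent vertex. A vertex $v$ is $k$-reachable under $D$ if some sequence of pebbling moves, each legal at the moment it is made, results in at least $k$ pebbles on $v$; reachable means $1$-reachable. $D$ is solvable if every vertex is reachable. The optimal pebbling number $\pi^*(G)$ is the minimum size of a solvable distribution on $G$. *)

theory Defs
  imports Complex_Main "Graph_Theory.Graph_Theory"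
begin

text \<open>
  A finite simple graph is a \<^locale>\<open>pair_graph\<close>: a finite vertex set with a finite, symmetric,
  loop-free set of arcs, an edge \<open>uv\<close> being the two arcs \<open>(u, v)\<close> and \<open>(v, u)\<close>. The out-degree
  of a vertex is therefore its usual degree.
\<close>

definition min_degree :: "'a pair_pre_digraph \<Rightarrow> nat" where
  "min_degree G = Min (out_degree (with_proj G) ` pverts G)"

text \<open>Distances are shortest-path costs with unit weights, so \<open>\<infinity>\<close> between different components.\<close>

definition graph_dist :: "'a pair_pre_digraph \<Rightarrow> 'a \<Rightarrow> 'a \<Rightarrow> ereal" where
  "graph_dist G u v = wf_digraph.\<mu> (with_proj G) (\<lambda>_. 1) u v"

definition graph_diameter :: "'a pair_pre_digraph \<Rightarrow> ereal" where
  "graph_diameter G = (SUP u \<in> pverts G. SUP v \<in> pverts G. graph_dist G u v)"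

text \<open>
  Pebbling distributions are functions on the whole vertex type. Values outside
  \<^term>\<open>pverts G\<close> are immaterial: sizes only sum over \<^term>\<open>pverts G\<close> and moves only use arcs of
  \<^term>\<open>G\<close>.
\<close>

type_synonym 'a pebbling_distribution = "'a \<Rightarrow> nat"

definition pebbling_size :: "'a pair_pre_digraph \<Rightarrow> 'a pebbling_distribution \<Rightarrow> nat" where
  "pebbling_size G D = (\<Sum>v \<in> pverts G. D v)"

definition pebbling_move ::
  "'a pair_pre_digraph \<Rightarrow> 'a pebbling_distribution \<Rightarrow> 'a pebbling_distribution \<Rightarrow> bool" where
  "pebbling_move G D D' \<longleftrightarrow>
     (\<exists>u v. (u, v) \<in> parcs G \<and> 2 \<le> D u \<and> D' = D(u := D u - 2, v := D v + 1))"

definition pebbling_k_reachable ::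
  "'a pair_pre_digraph \<Rightarrow> 'a pebbling_distribution \<Rightarrow> nat \<Rightarrow> 'a \<Rightarrow> bool" where
  "pebbling_k_reachable G D k v \<longleftrightarrow> (\<exists>D'. (pebbling_move G)\<^sup>*\<^sup>* D D' \<and> k \<le> D' v)"

definition pebbling_solvable :: "'a pair_pre_digraph \<Rightarrow> 'a pebbling_distribution \<Rightarrow> bool" where
  "pebbling_solvable G D \<longleftrightarrow> (\<forall>v \<in> pverts G. pebbling_k_reachable G D 1 v)"

text \<open>The minimum is attained: one pebble on every vertex is solvable.\<close>

definition optimal_pebbling_number :: "'a pair_pre_digraph \<Rightarrow> nat" where
  "optimal_pebbling_number G = (LEAST m. \<exists>D. pebbling_solvable G D \<and> pebbling_size G D = m)"

end

theory Submission
  imports Defs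
begin

text \<open>
  In a graph of diameter two, four pebbles on one vertex reach everything, so the bound needs
  optimal pebbling number 4 together with minimum degree \<open>(1 - o(1)) n\<close>. The complement of
  the \<open>m \<times> m\<close> rook's graph has both: its vertices are the cells of a board, adjacent when they
  differ in both coordinates, so only \<open>2 m - 1\<close> cells are not adjacent to a given one. Three pebbles
  that allow a move occupy at most two cells, and any two cells have a common non-neighbour \<open>x\<close>
  elsewhere on the board. Give \<open>x\<close> weight 4, its neighbours weight 2 and all other cells
  weight 1: moves do not increase the total weight, which starts at 3, so \<open>x\<close> is not reachable.
\<close>

section \<open>Lower bounds for the optimal pebbling number\<close>

context pair_graph
begin

text \<open>A move trades two pebbles of weight \<open>f u\<close> for one of weight
  \<open>f v\<close>, so the hypothesis on \<open>f\<close> says exactly that no move gains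
  weight.\<close>

lemma pebbling_move_weight_le:
  fixes f :: "'a \<Rightarrow> nat"
  assumes f: "\<And>u v. (u, v) \<in> parcs G \<Longrightarrow> f v \<le> 2 * f u"
    and "pebbling_move G D D'"
  shows "(\<Sum>v\<in>pverts G. f v * D' v) \<le> (\<Sum>v\<in>pverts G. f v * D v)"
proof -
  obtain u v where uv: "(u, v) \<in> parcs G" "2 \<le> D u" and D': "D' = D(u := D u - 2, v := D v + 1)"
    using assms(2) unfolding pebbling_move_def by blast
  have V: "u \<in> pverts G" "v \<in> pverts G" and "u \<noteq> v"
    using uv(1) wellformed' pair_no_loops by fastforce+
  have split: "(\<Sum>x\<in>pverts G. f x * E x)
      = f u * E u + (f v * E v + (\<Sum>x\<in>pverts G - {u} - {v}. f x * E x))" for E :: "'a \<Rightarrow> nat"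
    using V \<open>u \<noteq> v\<close> pair_finite_verts
    by (simp add: sum.remove[of "pverts G" u] sum.remove[of "pverts G - {u}" v])
  have rest: "(\<Sum>x\<in>pverts G - {u} - {v}. f x * D' x) = (\<Sum>x\<in>pverts G - {u} - {v}. f x * D x)"
    by (rule sum.cong) (auto simp: D')
  \<comment> \<open>Writing \<open>D u\<close> this way removes the truncated subtraction
    \<open>D u - 2\<close>.\<close>
  obtain k where k: "D u = k + 2"
    using uv(2) by (metis add.commute le_iff_add)
  show ?thesis
    unfolding split[of D'] split[of D] rest
    using \<open>u \<noteq> v\<close> f[OF uv(1)] by (simp add: D' k algebra_simps)
qed

text \<open>The weight never rises, and \<open>k\<close> pebbles on \<open>x\<close> already weigh
  \<open>k * f x\<close>. This serves as an obstruction to reachability.\<close>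

lemma pebbling_reachable_weight_le:
  fixes f :: "'a \<Rightarrow> nat"
  assumes f: "\<And>u v. (u, v) \<in> parcs G \<Longrightarrow> f v \<le> 2 * f u"
    and "pebbling_k_reachable G D k x" "x \<in> pverts G"
  shows "k * f x \<le> (\<Sum>v\<in>pverts G. f v * D v)"
proof -
  obtain D' where D': "(pebbling_move G)\<^sup>*\<^sup>* D D'" "k \<le> D' x"
    using assms(2) unfolding pebbling_k_reachable_def by blast
  from D'(1) have "(\<Sum>v\<in>pverts G. f v * D' v) \<le> (\<Sum>v\<in>pverts G. f v * D v)"
    by induction (auto intro: order_trans pebbling_move_weight_le[OF f])
  moreover have "f x * D' x \<le> (\<Sum>v\<in>pverts G. f v * D' v)"
    using assms(3) pair_finite_verts by (intro member_le_sum) auto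
  moreover have "k * f x \<le> f x * D' x"
    using D'(2) by (simp add: mult.commute)
  ultimately show ?thesis by linarith
qed

lemma pebbling_solvable_const_one: "pebbling_solvable G (\<lambda>_. 1)"
  unfolding pebbling_solvable_def pebbling_k_reachable_def by auto

text \<open>If no vertex holds two pebbles, no move is legal and every vertex needs a pebble of its
  own. Otherwise three pebbles would occupy at most two vertices, and a weight centred at a common
  non-neighbour shows that vertex unreachable.\<close>

lemma solvable_size_ge_4:
  assumes card: "4 \<le> card (pverts G)"
    and nonadj: "\<And>u w. u \<in> pverts G \<Longrightarrow> w \<in> pverts G \<Longrightarrow>
      \<exists>x \<in> pverts G - {u, w}. (u, x) \<notin> parcs G \<and> (w, x) \<notin> parcs G"
    and solv: "pebbling_solvable G D"
  shows "4 \<le> pebbling_size G D"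
proof (cases "\<exists>u \<in> pverts G. 2 \<le> D u")
  case False
  then have "\<not> pebbling_move G D D'" for D'
    using wellformed' unfolding pebbling_move_def by blast
  then have "1 \<le> D v" if "v \<in> pverts G" for v
    using solv that unfolding pebbling_solvable_def pebbling_k_reachable_def
    by (metis converse_rtranclpE)
  then have "card (pverts G) \<le> pebbling_size G D"
    unfolding pebbling_size_def using sum_mono[of "pverts G" "\<lambda>_. 1" D] by simp
  with card show ?thesis by simp
next
  case True
  then obtain u where u: "u \<in> pverts G" "2 \<le> D u" by blast
  show ?thesis
  proof (rule ccontr)
    assume "\<not> 4 \<le> pebbling_size G D"
    then have small: "(\<Sum>v\<in>pverts G. D v) \<le> 3"
      by (simp add: pebbling_size_def)
    \<comment> \<open>Two of the at most three pebbles lie on \<open>u\<close>, so at most one lies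
      elsewhere. If none does, \<open>w = u\<close> serves.\<close>
    have "\<exists>w \<in> pverts G. \<forall>v \<in> pverts G - {u, w}. D v = 0"
    proof (cases "\<forall>v \<in> pverts G - {u}. D v = 0")
      case True
      with u(1) show ?thesis by auto
    next
      case False
      then obtain w where w: "w \<in> pverts G" "w \<noteq> u" "1 \<le> D w" by force
      have "(\<Sum>v\<in>pverts G. D v) = D u + (D w + (\<Sum>v\<in>pverts G - {u} - {w}. D v))"
        using u(1) w pair_finite_verts
        by (simp add: sum.remove[of "pverts G" u] sum.remove[of "pverts G - {u}" w])
      then have "(\<Sum>v\<in>pverts G - {u} - {w}. D v) = 0"
        using small u(2) w(3) by linarith
      then have "\<forall>v \<in> pverts G - {u, w}. D v = 0"
        using pair_finite_verts by auto
      with w(1) show ?thesis by blast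
    qed
    then obtain w where w: "w \<in> pverts G" "\<And>v. v \<in> pverts G \<Longrightarrow> v \<noteq> u \<Longrightarrow> v \<noteq> w \<Longrightarrow> D v = 0"
      by blast
    obtain x where x: "x \<in> pverts G" "x \<noteq> u" "x \<noteq> w" "(u, x) \<notin> parcs G" "(w, x) \<notin> parcs G"
      using nonadj[OF u(1) w(1)] by blast
    define f :: "'a \<Rightarrow> nat"
      where "f v = (if v = x then 4 else if (v, x) \<in> parcs G then 2 else 1)" for v
    \<comment> \<open>Weight 4 occurs only at \<open>b = x\<close>, where \<open>a\<close> is a
      neighbour of \<open>x\<close> and weighs 2; any other \<open>b\<close> weighs at most
      2.\<close>
    have "f b \<le> 2 * f a" if "(a, b) \<in> parcs G" for a b
      using that pair_no_loops[OF that] by (auto simp: f_def)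
    moreover have "pebbling_k_reachable G D 1 x"
      using solv x(1) by (simp add: pebbling_solvable_def)
    ultimately have "1 * f x \<le> (\<Sum>v\<in>pverts G. f v * D v)"
      using x(1) by (rule pebbling_reachable_weight_le)
    \<comment> \<open>All pebbles lie on \<open>u\<close> and \<open>w\<close>, which have weight
      1.\<close>
    also have "\<dots> = (\<Sum>v\<in>pverts G. D v)"
    proof (rule sum.cong)
      fix v assume "v \<in> pverts G"
      then show "f v * D v = D v"
        using w(2)[of v] x by (cases "v = u \<or> v = w") (auto simp: f_def)
    qed simp
    finally show False
      using small by (simp add: f_def)
  qed
qed

lemma optimal_pebbling_number_ge_4:
  assumes "4 \<le> card (pverts G)"
    and "\<And>u w. u \<in> pverts G \<Longrightarrow> w \<in> pverts G \<Longrightarrow>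
      \<exists>x \<in> pverts G - {u, w}. (u, x) \<notin> parcs G \<and> (w, x) \<notin> parcs G"
  shows "4 \<le> optimal_pebbling_number G"
proof -
  have "\<exists>D. pebbling_solvable G D \<and> pebbling_size G D = optimal_pebbling_number G"
    unfolding optimal_pebbling_number_def
    by (rule LeastI_ex) (use pebbling_solvable_const_one in blast)
  then show ?thesis
    using solvable_size_ge_4[OF assms] by metis
qed

section \<open>Diameter two\<close>

text \<open>A common neighbour gives a walk of cost 2 between any two vertices; the non-adjacent
  pair \<open>a\<close>, \<open>b\<close> gives the lower bound.\<close>

lemma graph_diameter_eq_2:
  assumes common: "\<And>u v. u \<in> pverts G \<Longrightarrow> v \<in> pverts G \<Longrightarrow> \<exists>w. (u, w) \<in> parcs G \<and> (w, v) \<in> parcs G"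
    and ab: "a \<in> pverts G" "b \<in> pverts G" "a \<noteq> b" "(a, b) \<notin> parcs G"
  shows "graph_diameter G = 2"
proof (rule antisym)
  have "graph_dist G u v \<le> 2" if uv: "u \<in> pverts G" "v \<in> pverts G" for u v
  proof -
    obtain w where "(u, w) \<in> parcs G" "(w, v) \<in> parcs G"
      using common[OF uv] by blast
    then have "awalk u [(u, w), (w, v)] v"
      using uv by (simp add: awalk_simps)
    from min_cost_le_walk_cost[OF this, of "\<lambda>_. 1"] show ?thesis
      by (simp add: graph_dist_def)
  qed
  then show "graph_diameter G \<le> 2"
    unfolding graph_diameter_def by (intro SUP_least)
  \<comment> \<open>The empty walk is excluded by \<open>a \<noteq> b\<close>, a single arc by
    non-adjacency.\<close>
  have "2 \<le> awalk_cost (\<lambda>_. 1) p" if "awalk a p b" for p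
  proof (cases p)
    case Nil
    with that ab show ?thesis by (simp add: awalk_simps)
  next
    case (Cons e q)
    with that ab have "q \<noteq> []"
      by (cases e) (auto simp: awalk_simps)
    then obtain e' r where "q = e' # r" by (cases q) auto
    moreover from this have "0 \<le> awalk_cost (\<lambda>_. 1) r"
      using that Cons by (auto simp: awalk_simps intro: pos_cost_pos_awalk_cost)
    ultimately show ?thesis
      using Cons by simp
  qed
  then have "2 \<le> graph_dist G a b"
    unfolding graph_dist_def \<mu>_def by (auto intro!: INF_greatest)
  also have "\<dots> \<le> graph_diameter G"
    unfolding graph_diameter_def by (rule SUP_upper2[OF ab(1) SUP_upper[OF ab(2)]])
  finally show "2 \<le> graph_diameter G" .
qed

lemma connected_if_common_neighbours:
  assumes "pverts G \<noteq> {}"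
    and common: "\<And>u v. u \<in> pverts G \<Longrightarrow> v \<in> pverts G \<Longrightarrow> \<exists>w. (u, w) \<in> parcs G \<and> (w, v) \<in> parcs G"
  shows "Digraph_Component.connected (with_proj G)"
proof -
  have "(u, v) \<in> rtrancl_on (pverts G) ((parcs G)\<^sup>s)" if uv: "u \<in> pverts G" "v \<in> pverts G" for u v
  proof -
    obtain w where w: "(u, w) \<in> parcs G" "(w, v) \<in> parcs G"
      using common[OF uv] by blast
    then have "w \<in> pverts G" using wellformed' by blast
    with w uv show ?thesis
      by (auto simp: symcl_def intro: rtrancl_on_into_rtrancl_on[OF
          rtrancl_on_into_rtrancl_on[OF rtrancl_on_refl]])
  qed
  with assms(1) show ?thesis
    by (simp add: connected_conv)
qed

lemma min_degree_ge:
  assumes "pverts G \<noteq> {}"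
    and "\<And>u. u \<in> pverts G \<Longrightarrow> k \<le> card {v. (u, v) \<in> parcs G}"
  shows "k \<le> min_degree G"
proof -
  have "out_degree (with_proj G) u = card {v. (u, v) \<in> parcs G}" for u
  proof -
    have "out_arcs (with_proj G) u = Pair u ` {v. (u, v) \<in> parcs G}"
      by (auto simp: out_arcs_def)
    then show ?thesis
      by (simp add: out_degree_def card_image inj_on_def)
  qed
  with assms show ?thesis
    unfolding min_degree_def using pair_finite_verts by (subst Min_ge_iff) auto
qed

end

section \<open>The complement of the rook's graph\<close>

text \<open>The cell in row \<open>i\<close> and column \<open>j\<close> of the \<open>m \<times> m\<close> board is the number \<open>i * m + j\<close>.\<close>

definition corook :: "nat \<Rightarrow> nat pair_pre_digraph" where
  "corook m = \<lparr> pverts = {..<m * m},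
     parcs = {(p, q). p < m * m \<and> q < m * m \<and> p div m \<noteq> q div m \<and> p mod m \<noteq> q mod m} \<rparr>"

lemma pverts_corook [simp]: "pverts (corook m) = {..<m * m}"
  by (simp add: corook_def)

lemma parcs_corook [simp]:
  "(p, q) \<in> parcs (corook m) \<longleftrightarrow>
     p < m * m \<and> q < m * m \<and> p div m \<noteq> q div m \<and> p mod m \<noteq> q mod m"
  by (simp add: corook_def)

lemma pair_graph_corook: "pair_graph (corook m)"
proof
  show "finite (parcs (corook m))"
    by (rule finite_subset[of _ "{..<m * m} \<times> {..<m * m}"]) auto
  show "symmetric (with_proj (corook m))"
    by (auto simp: symmetric_def intro!: symI)
qed auto

lemma cell_less:
  fixes i j m :: nat
  assumes "i < m" "j < m"
  shows "i * m + j < m * m"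
proof -
  have "i * m + j < Suc i * m" using assms(2) by simp
  also have "\<dots> \<le> m * m" using assms(1) by (intro mult_le_mono1) simp
  finally show ?thesis .
qed

lemma cell_coords:
  fixes p m :: nat
  assumes "p < m * m"
  shows "p div m < m" "p mod m < m"
  using assms by (cases "m = 0"; simp add: less_mult_imp_div_less)+

lemma exists_less_avoiding_two:
  fixes m :: nat
  assumes "3 \<le> m"
  shows "\<exists>k<m. k \<noteq> a \<and> k \<noteq> b"
proof -
  have "card {a, b} < card {..<m}"
    using assms card_insert_le_m1[of 2 "{b}" a] by simp
  then have "\<not> {..<m} \<subseteq> {a, b}"
    by (meson card_mono finite.intros linorder_not_le)
  then show ?thesis by auto
qed

text \<open>With at least three rows and columns, some row and some column avoid both cells; they
  meet in the common neighbour.\<close>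

lemma corook_common_neighbour:
  assumes "3 \<le> m" "p < m * m" "q < m * m"
  shows "\<exists>r. (p, r) \<in> parcs (corook m) \<and> (r, q) \<in> parcs (corook m)"
proof -
  obtain i j where "i < m" "i \<noteq> p div m" "i \<noteq> q div m" "j < m" "j \<noteq> p mod m" "j \<noteq> q mod m"
    using exists_less_avoiding_two[OF assms(1)] by metis
  then show ?thesis
    using assms cell_less[of i m j] by (intro exI[of _ "i * m + j"]) auto
qed

text \<open>The cell sought shares a line with \<open>p\<close> and a line with \<open>q\<close>. If
  \<open>p\<close> and \<open>q\<close> lie in one row or column, a further cell of that line works;
  otherwise it is the corner in the row of \<open>p\<close> and the column of
  \<open>q\<close>.\<close>

lemma corook_common_nonneighbour:
  assumes "3 \<le> m" "p < m * m" "q < m * m"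
  shows "\<exists>r \<in> {..<m * m} - {p, q}. (p, r) \<notin> parcs (corook m) \<and> (q, r) \<notin> parcs (corook m)"
proof -
  note c = cell_coords[OF assms(2)] cell_coords[OF assms(3)]
  obtain i j where ij: "i < m" "j < m"
    and off: "(i, j) \<noteq> (p div m, p mod m)" "(i, j) \<noteq> (q div m, q mod m)"
    and line: "i = p div m \<or> j = p mod m" "i = q div m \<or> j = q mod m"
  proof (cases "p div m = q div m")
    case True
    with that[of "p div m"] c exists_less_avoiding_two[OF assms(1), of "p mod m" "q mod m"]
    show ?thesis by auto
  next
    case row: False
    show ?thesis
    proof (cases "p mod m = q mod m")
      case True
      with that[of _ "p mod m"] c exists_less_avoiding_two[OF assms(1), of "p div m" "q div m"]
      show ?thesis by auto
    next
      case False
      with row that[of "p div m" "q mod m"] c show ?thesis by auto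
    qed
  qed
  have coords: "(i * m + j) div m = i" "(i * m + j) mod m = j"
    using ij by auto
  then have "i * m + j \<noteq> p" "i * m + j \<noteq> q"
    using off by auto
  with line cell_less[OF ij] show ?thesis
    by (intro bexI[of _ "i * m + j"]) (auto simp: coords)
qed

text \<open>Every cell outside the row \<open>R\<close> and the column \<open>C\<close> of
  \<open>p\<close> is a neighbour. Bounding their union by \<open>2 * m\<close> counts
  \<open>p\<close> twice, which is harmless asymptotically.\<close>

lemma corook_degree_ge:
  assumes "p < m * m"
  shows "m * m - 2 * m \<le> card {q. (p, q) \<in> parcs (corook m)}"
proof -
  define R where "R = (\<lambda>j. p div m * m + j) ` {..<m}"
  define C where "C = (\<lambda>i. i * m + p mod m) ` {..<m}"
  have cards: "card R \<le> m" "card C \<le> m"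
    unfolding R_def C_def using card_image_le[of "{..<m}"] by simp_all
  have "q \<in> R" if "q < m * m" "p div m = q div m" for q
    unfolding R_def using that cell_coords[of q m]
    by (intro image_eqI[of _ _ "q mod m"]) (auto simp: div_mult_mod_eq)
  moreover have "q \<in> C" if "q < m * m" "p mod m = q mod m" for q
    unfolding C_def using that cell_coords[of q m]
    by (intro image_eqI[of _ _ "q div m"]) (auto simp: div_mult_mod_eq)
  ultimately have sub: "{..<m * m} - (R \<union> C) \<subseteq> {q. (p, q) \<in> parcs (corook m)}"
    using assms by auto
  have "m * m - 2 * m \<le> card {..<m * m} - card (R \<union> C)"
    using card_Un_le[of R C] cards by simp
  also have "\<dots> \<le> card ({..<m * m} - (R \<union> C))"
    by (rule diff_card_le_card_Diff) (simp add: R_def C_def)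
  also have "\<dots> \<le> card {q. (p, q) \<in> parcs (corook m)}"
    using sub by (intro card_mono) (auto intro: finite_subset[of _ "{..<m * m}"])
  finally show ?thesis .
qed

theorem theorem1:
  fixes \<epsilon> :: real
  assumes "\<epsilon> > 0"
  shows "\<exists>(G :: nat pair_pre_digraph) (n :: nat) (\<delta> :: nat).
           pair_graph G \<and> Digraph_Component.connected (with_proj G) \<and> graph_diameter G = 2 \<and>
           n = card (pverts G) \<and> \<delta> = min_degree G \<and>
           real (optimal_pebbling_number G) > (4 - \<epsilon>) * real n / (real \<delta> + 1)"
proof -
  \<comment> \<open>The constant 8 makes \<open>(4 - \<epsilon>) * m * m\<close> at most
    \<open>4 * (m * m - 2 * m)\<close>; the \<open>+ 1\<close> in the denominator then gives
    strictness.\<close>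
  obtain m where m: "3 \<le> m" "8 / \<epsilon> \<le> real m"
    by (metis linorder_linear order_trans real_arch_simple of_nat_mono)
  interpret pair_graph "corook m" by (rule pair_graph_corook)
  have nine: "9 \<le> m * m" using mult_le_mono[OF m(1) m(1)] by simp
  \<comment> \<open>This ensures that \<open>m * m - 2 * m\<close> is not truncated when cast to the
    reals.\<close>
  have mm: "3 * m \<le> m * m" using m(1) by (rule mult_le_mono1)
  have ne: "pverts (corook m) \<noteq> {}" using m(1) by (auto simp: lessThan_empty_iff)
  have common: "\<exists>w. (u, w) \<in> parcs (corook m) \<and> (w, v) \<in> parcs (corook m)"
    if "u \<in> pverts (corook m)" "v \<in> pverts (corook m)" for u v
    using corook_common_neighbour[OF m(1)] that by simp
  have "graph_diameter (corook m) = 2"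
    \<comment> \<open>Cells 0 and 1 both lie in row 0, hence are not adjacent.\<close>
    by (rule graph_diameter_eq_2[OF common, of 0 1]) (use m(1) nine in simp_all)
  moreover have "Digraph_Component.connected (with_proj (corook m))"
    using ne common by (rule connected_if_common_neighbours)
  moreover have "(4 - \<epsilon>) * real (card (pverts (corook m))) / (real (min_degree (corook m)) + 1)
      < real (optimal_pebbling_number (corook m))"
  proof -
    have "m * m - 2 * m \<le> min_degree (corook m)"
      using ne corook_degree_ge by (intro min_degree_ge) auto
    then have \<delta>: "real m * real m - 2 * real m \<le> real (min_degree (corook m))"
      using mm by (simp add: of_nat_diff flip: of_nat_mult of_nat_add)
    have "8 \<le> \<epsilon> * real m"
      using m(2) assms by (simp add: field_simps)
    then have "8 * real m \<le> \<epsilon> * real m * real m"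
      by (rule mult_right_mono) simp
    then have "(4 - \<epsilon>) * real (m * m) < 4 * (real (min_degree (corook m)) + 1)"
      using \<delta> by (simp add: algebra_simps)
    then have "(4 - \<epsilon>) * real (m * m) / (real (min_degree (corook m)) + 1) < 4"
      by (simp add: divide_simps)
    moreover have "4 \<le> optimal_pebbling_number (corook m)"
      using corook_common_nonneighbour[OF m(1)] nine
      by (intro optimal_pebbling_number_ge_4) auto
    ultimately show ?thesis by simp
  qed
  ultimately show ?thesis
    using pair_graph_corook by blast
qed

end
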